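(* Let $G=(V,E)$ be a finite connected graph with positive measure $\mu:V\to(0,\infty)$ and positive symmetric weights $w_{xy}=w_{yx}$ on the edges $xy\in E$. Let $a>0$ be a constant and let $f:\mathbb{R}\to\mathbb{R}$ be of the form $f(u)=ae^u+g(u)e^u$, with $f(u)>0$ for all $u\in\mathbb{R}$, where $g:\mathbb{R}\to\mathbb{R}$ is bounded and $g(u)\to 0$ as $u\to\pm\infty$. Assume $h\in V^{\mathbb{R}}$ and $c\in\mathbb{R}$ satisfy: (1) if $c>0$, then there exists $x_0\in V$ such that $h(x_0)>0$; (2) if $c=0$, then $h$ changes sign and $\int_V h\,d\mu<0$; (3) if $c<0$, then there exists $x_0\in V$ such that $h(x_0)<0$. Then there exists a constant $C$ depending on $h,c,G$ (with $f$ fixed) such that every solution $u\in V^{\mathbb{R}}$ to $$-\Delta u(x)=h(x)f(u(x))-c,\qquad x\in V,$$ satisfies $\max_{x\in V}|u(x)|\le C$.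
   Context: $V$ is the vertex set and $E$ the edge set of the graph; $V^{\mathbb{R}}$ denotes the space of all real-valued functions on $V$. The Laplace operator is $\Delta u(x)=\frac{1}{\mu(x)}\sum_{y\sim x}w_{xy}(u(y)-u(x))$, where $y\sim x$ means $xy\in E$. The integral of $h\in V^{\mathbb{R}}$ is $\int_V h\,d\mu=\sum_{x\in V}\mu(x)h(x)$. "$h$ changes sign" means that $h$ takes both positive and negative values on $V$. The data $G$ include $\mu$ and the weights $w_{xy}$. *)

theory Defs
  imports "HOL-Analysis.Analysis" "Graph_Theory.Digraph_Component"
begin

(* An undirected simple graph is a symmetric, loop-free pair digraph: the edge xy is represented by
   the two arcs (x, y) and (y, x). Functions on the vertex set are total functions on the vertex
   type of which only the values on the vertex set matter. *)

definition graph_laplacian ::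
  "'a pair_pre_digraph \<Rightarrow> ('a \<Rightarrow> real) \<Rightarrow> ('a \<Rightarrow> 'a \<Rightarrow> real) \<Rightarrow> ('a \<Rightarrow> real) \<Rightarrow> 'a \<Rightarrow> real" where
  "graph_laplacian G \<mu> w u x =
     1 / \<mu> x * (\<Sum>y | (x, y) \<in> parcs G. w x y * (u y - u x))"

definition graph_integral :: "'a pair_pre_digraph \<Rightarrow> ('a \<Rightarrow> real) \<Rightarrow> ('a \<Rightarrow> real) \<Rightarrow> real" where
  "graph_integral G \<mu> h = (\<Sum>x\<in>pverts G. \<mu> x * h x)"

definition changes_sign :: "'a pair_pre_digraph \<Rightarrow> ('a \<Rightarrow> real) \<Rightarrow> bool" where
  "changes_sign G h \<longleftrightarrow> (\<exists>x\<in>pverts G. h x > 0) \<and> (\<exists>x\<in>pverts G. h x < 0)"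

end

theory Submission
  imports Defs "HOL-Real_Asymp.Real_Asymp"
begin

text \<open>A solution is bounded below by a compactness argument and then above by a maximum
  argument, with bounds uniform over all solutions. Both rest on a Harnack-type estimate on the
  finite connected graph, \<open>harnack\<close>: if \<open>- lap u\<close> is at most
  \<open>b\<close> wherever \<open>u\<close> is within \<open>K * b\<close> of its maximum, then
  \<open>u\<close> stays within \<open>K * b\<close> of its maximum everywhere, with
  \<open>K\<close> depending only on the graph.

  Below (\<open>solution_lower_bound\<close>): along solutions whose minima tend to minus infinity,
  the estimate for \<open>- u\<close> bounds the oscillation, so all values tend to minus infinity
  and \<open>f\<close> of them tends to 0. Integrating the equation gives \<open>c = 0\<close>;
  after division by the exponential of the minimum, the limit of the integrated equation is
  \<open>a\<close> times the integral of \<open>h\<close>, which must vanish. Condition (2) rules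
  this out.

  Above (\<open>solution_upper_bound\<close>): given the lower bound, a large value is impossible
  where \<open>h > 0\<close>, since \<open>f\<close> outgrows the linear bound on
  \<open>- lap u\<close>. The estimate then makes \<open>u\<close> large everywhere with bounded
  oscillation, which is impossible at a point where \<open>h < 0\<close>. Each sign condition
  guarantees that \<open>h\<close> is not identically zero.\<close>

locale weighted_graph =
  fixes V :: "'a set" and E :: "('a \<times> 'a) set" and w :: "'a \<Rightarrow> 'a \<Rightarrow> real"
  assumes finite_V: "finite V" and V_nonempty: "V \<noteq> {}"
    and E_subset: "E \<subseteq> V \<times> V" and sym_E: "sym E"
    and connected_E: "\<And>x y. x \<in> V \<Longrightarrow> y \<in> V \<Longrightarrow> (x, y) \<in> E\<^sup>*"
    and w_pos: "\<And>x y. (x, y) \<in> E \<Longrightarrow> w x y > 0"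
    and w_sym: "\<And>x y. (x, y) \<in> E \<Longrightarrow> w x y = w y x"
begin

text \<open>The Laplacian multiplied by \<open>\<mu>\<close>: without the factor
  \<open>1 / \<mu> x\<close>, its plain sum over \<open>V\<close> is the integral of the Laplacian,
  and the graph estimates do not involve the measure.\<close>

definition lap :: "('a \<Rightarrow> real) \<Rightarrow> 'a \<Rightarrow> real" where
  "lap u x = (\<Sum>y | (x, y) \<in> E. w x y * (u y - u x))"

definition deg :: "'a \<Rightarrow> real" where
  "deg x = (\<Sum>y | (x, y) \<in> E. w x y)"

lemma finite_nbrs: "finite {y. (x, y) \<in> E}"
  by (rule finite_subset[OF _ finite_V]) (use E_subset in auto)

lemma deg_nonneg: "deg x \<ge> 0"
  unfolding deg_def by (rule sum_nonneg) (use w_pos in \<open>auto simp: less_imp_le\<close>)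

lemma lap_uminus: "lap (\<lambda>x. - u x) x = - lap u x"
  by (simp add: lap_def sum_negf[symmetric] algebra_simps)

lemma lap_le:
  assumes "\<And>y. (x, y) \<in> E \<Longrightarrow> u y - u x \<le> B"
  shows "lap u x \<le> deg x * B"
  unfolding lap_def deg_def sum_distrib_right
  by (rule sum_mono) (use assms w_pos in \<open>auto intro!: mult_left_mono simp: less_imp_le\<close>)

text \<open>The summand is antisymmetric under reversal of an arc, so the sum over all arcs equals
  its own negative.\<close>

lemma sum_lap: "(\<Sum>x\<in>V. lap u x) = 0"
proof -
  let ?t = "\<lambda>(x, y). w x y * (u y - u x)"
  have "(\<Sum>x\<in>V. lap u x) = sum ?t (Sigma V (\<lambda>x. {y. (x, y) \<in> E}))"
    unfolding lap_def by (rule sum.Sigma) (auto simp: finite_V finite_nbrs)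
  also have "Sigma V (\<lambda>x. {y. (x, y) \<in> E}) = E"
    using E_subset by auto
  finally have 1: "(\<Sum>x\<in>V. lap u x) = sum ?t E" .
  have "sum ?t E = sum (\<lambda>p. ?t (prod.swap p)) E"
    by (rule sum.reindex_bij_witness[of _ prod.swap prod.swap])
      (use sym_E in \<open>auto dest: symD\<close>)
  also have "\<dots> = sum (\<lambda>p. - ?t p) E"
    by (rule sum.cong) (auto simp: algebra_simps dest: w_sym)
  finally show ?thesis
    unfolding 1 sum_negf by simp
qed

section \<open>Harnack-type estimate\<close>

text \<open>The bound travels along a path from the maximum point. At a vertex \<open>y\<close> near
  the maximum, no neighbour can rise much above \<open>u y\<close>, so a deep drop to one neighbour
  \<open>z\<close> would make \<open>- lap u y\<close> exceed \<open>b\<close>. The constant is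
  fixed before \<open>u\<close> and \<open>b\<close>, so it depends only on the weighted
  graph.\<close>

lemma harnack_reachable:
  assumes "(x, y) \<in> E\<^sup>*" "x \<in> V"
  shows "\<exists>K\<ge>0. \<forall>u b. b \<ge> 0 \<longrightarrow> (\<forall>z\<in>V. u z \<le> u x) \<longrightarrow>
           (\<forall>z\<in>V. u x - K * b \<le> u z \<longrightarrow> - lap u z \<le> b) \<longrightarrow> u x - K * b \<le> u y"
  using assms(1)
proof induction
  case base
  show ?case by (intro exI[of _ 0]) auto
next
  case (step y z)
  then obtain K where K: "K \<ge> 0" and
    IH: "\<And>u b. b \<ge> 0 \<Longrightarrow> (\<forall>z\<in>V. u z \<le> u x) \<Longrightarrow>
          (\<forall>z\<in>V. u x - K * b \<le> u z \<longrightarrow> - lap u z \<le> b) \<Longrightarrow> u x - K * b \<le> u y"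
    by blast
  have wpos: "w y z > 0" using step(2) w_pos by blast
  have yV: "y \<in> V" using step(2) E_subset by auto
  \<comment> \<open>The drop from \<open>y\<close> to \<open>z\<close>, times \<open>w y z\<close>,
    is at most \<open>- lap u y + deg y * (u x - u y)\<close>, hence at most
    \<open>(1 + deg y * K) * b\<close>.\<close>
  define K' where "K' = K + (1 + deg y * K) / w y z"
  have K'_ge: "K' \<ge> K"
    unfolding K'_def using K wpos deg_nonneg[of y] by simp
  have "u x - K' * b \<le> u z"
    if b: "b \<ge> 0" and max: "\<forall>z\<in>V. u z \<le> u x"
      and L: "\<forall>z\<in>V. u x - K' * b \<le> u z \<longrightarrow> - lap u z \<le> b" for u b
  proof -
    have Kb: "K * b \<le> K' * b" using K'_ge b by (rule mult_right_mono)
    have uy: "u x - K * b \<le> u y"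
      using IH[OF b max] L Kb by (meson diff_left_mono order_trans)
    then have "- lap u y \<le> b" using L yV Kb by force
    moreover have "lap u y + w y z * (u y - u z) \<le> deg y * (u x - u y)"
    proof -
      have fin: "finite {v. (y, v) \<in> E}" by (rule finite_nbrs)
      have "lap u y = w y z * (u z - u y) + (\<Sum>v\<in>{v. (y, v) \<in> E} - {z}. w y v * (u v - u y))"
        unfolding lap_def using step(2) by (intro sum.remove[OF fin]) auto
      also have "(\<Sum>v\<in>{v. (y, v) \<in> E} - {z}. w y v * (u v - u y))
          \<le> (\<Sum>v\<in>{v. (y, v) \<in> E} - {z}. w y v * (u x - u y))"
        using max E_subset w_pos by (intro sum_mono mult_left_mono) (auto simp: less_imp_le)
      \<comment> \<open>The term for \<open>z\<close> is put back, being nonnegative, so that the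
        full degree of \<open>y\<close> appears.\<close>
      also have "\<dots> \<le> (\<Sum>v | (y, v) \<in> E. w y v * (u x - u y))"
        using fin max yV w_pos by (intro sum_mono2) (auto simp: less_imp_le)
      finally have "lap u y \<le> w y z * (u z - u y) + deg y * (u x - u y)"
        by (simp add: deg_def sum_distrib_right)
      then show ?thesis by (simp add: algebra_simps)
    qed
    moreover have "deg y * (u x - u y) \<le> deg y * (K * b)"
      using uy deg_nonneg by (intro mult_left_mono) auto
    ultimately have "w y z * (u y - u z) \<le> (1 + deg y * K) * b"
      by (simp add: algebra_simps)
    then have "u y - u z \<le> (1 + deg y * K) / w y z * b"
      using wpos by (simp add: field_simps)
    then show ?thesis using uy by (simp add: K'_def algebra_simps)
  qed
  then show ?case using K'_ge K by (intro exI[of _ K']) auto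
qed

text \<open>The bound on the Laplacian is only required where \<open>u\<close> is within the asserted distance
  of its maximum; for the Kazdan-Warner equation nothing better is known beforehand.\<close>
lemma harnack:
  obtains K where "K \<ge> 0"
    "\<And>u b x y. b \<ge> 0 \<Longrightarrow> x \<in> V \<Longrightarrow> (\<And>z. z \<in> V \<Longrightarrow> u z \<le> u x) \<Longrightarrow>
       (\<And>z. z \<in> V \<Longrightarrow> u x - K * b \<le> u z \<Longrightarrow> - lap u z \<le> b) \<Longrightarrow> y \<in> V \<Longrightarrow> u x - K * b \<le> u y"
proof -
  obtain k where k0: "\<And>x y. x \<in> V \<Longrightarrow> y \<in> V \<Longrightarrow> k x y \<ge> 0" and
    k: "\<And>x y u b. x \<in> V \<Longrightarrow> y \<in> V \<Longrightarrow> b \<ge> 0 \<Longrightarrow> (\<forall>z\<in>V. u z \<le> u x) \<Longrightarrow>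
          (\<forall>z\<in>V. u x - k x y * b \<le> u z \<longrightarrow> - lap u z \<le> b) \<Longrightarrow> u x - k x y * b \<le> u y"
    using harnack_reachable connected_E by metis
  \<comment> \<open>The sum of the nonnegative constants dominates each of them. Enlarging the
    constant is harmless: it strengthens the premise on \<open>lap\<close> and weakens the
    conclusion.\<close>
  define K where "K = (\<Sum>x\<in>V. \<Sum>y\<in>V. k x y)"
  have kK: "k x y \<le> K" if "x \<in> V" "y \<in> V" for x y
  proof -
    have "k x y \<le> (\<Sum>y\<in>V. k x y)"
      using that k0 finite_V by (intro member_le_sum) auto
    also have "\<dots> \<le> K"
      unfolding K_def using that k0 finite_V
      by (intro member_le_sum[of x V "\<lambda>x. \<Sum>y\<in>V. k x y"] sum_nonneg) auto
    finally show ?thesis .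
  qed
  show thesis
  proof (rule that[of K])
    show "K \<ge> 0" unfolding K_def by (intro sum_nonneg k0)
    fix u :: "'a \<Rightarrow> real" and b x y
    assume *: "b \<ge> 0" "x \<in> V" "\<And>z. z \<in> V \<Longrightarrow> u z \<le> u x"
      "\<And>z. z \<in> V \<Longrightarrow> u x - K * b \<le> u z \<Longrightarrow> - lap u z \<le> b" "y \<in> V"
    have "k x y * b \<le> K * b" using kK * by (intro mult_right_mono) auto
    then show "u x - K * b \<le> u y"
      using k[of x y b u] * by force
  qed
qed

section \<open>Integrated equation and lower bound\<close>

definition solution ::
  "('a \<Rightarrow> real) \<Rightarrow> ('a \<Rightarrow> real) \<Rightarrow> (real \<Rightarrow> real) \<Rightarrow> real \<Rightarrow> ('a \<Rightarrow> real) \<Rightarrow> bool" where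
  "solution \<mu> h f c u \<longleftrightarrow> (\<forall>x\<in>V. - lap u x = \<mu> x * (h x * f (u x) - c))"

lemma solution_integral:
  assumes "solution \<mu> h f c u"
  shows "(\<Sum>x\<in>V. \<mu> x * h x * f (u x)) = c * (\<Sum>x\<in>V. \<mu> x)"
proof -
  have "(\<Sum>x\<in>V. \<mu> x * (h x * f (u x) - c)) = (\<Sum>x\<in>V. - lap u x)"
    using assms by (intro sum.cong) (auto simp: solution_def)
  then have "(\<Sum>x\<in>V. \<mu> x * (h x * f (u x) - c)) = 0"
    by (simp add: sum_negf sum_lap)
  then show ?thesis
    by (simp add: algebra_simps sum_subtractf sum_distrib_left)
qed

text \<open>If the minima of a sequence of solutions tend to \<open>-\<infinity>\<close>, then so do all values, and the
  integrated equation forces \<open>c = 0\<close>. In that case the Laplacians are exponentially small, so the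
  solutions become asymptotically constant and \<open>h\<close> has integral zero.\<close>
lemma solution_lower_bound:
  assumes \<mu>: "\<And>x. x \<in> V \<Longrightarrow> \<mu> x > 0"
    and a: "a \<noteq> 0"
    and f: "\<And>t. f t = (a + g t) * exp t"
    and g: "bounded (range g)" "(g \<longlongrightarrow> 0) at_bot"
    and nondeg: "c \<noteq> 0 \<or> (\<Sum>x\<in>V. \<mu> x * h x) \<noteq> 0"
  obtains N where "\<And>u x. solution \<mu> h f c u \<Longrightarrow> x \<in> V \<Longrightarrow> - N \<le> u x"
proof (rule ccontr)
  assume "\<not> thesis"
  with that have "\<forall>n::nat. \<exists>u x. solution \<mu> h f c u \<and> x \<in> V \<and> u x < - real n"
    by (metis not_le)
  then obtain u p where sol: "\<And>n. solution \<mu> h f c (u n)" and pV: "\<And>n. p n \<in> V"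
    and up: "\<And>n. u n (p n) < - real n"
    by metis
  have "\<exists>q\<in>V. \<forall>z\<in>V. u n q \<le> u n z" for n
    using finite_V V_nonempty by (metis ex_is_arg_min_if_finite is_arg_min_linorder)
  then obtain q where qV: "\<And>n. q n \<in> V" and q: "\<And>n z. z \<in> V \<Longrightarrow> u n (q n) \<le> u n z"
    by metis
  define m where "m n = u n (q n)" for n
  have m_lim: "filterlim m at_bot sequentially"
  proof (rule filterlim_at_bot_mono)
    show "filterlim (\<lambda>n. - real n) at_bot sequentially" by real_asymp
    show "\<forall>\<^sub>F n in sequentially. m n \<le> - real n"
      using q pV up unfolding m_def by (meson always_eventually less_imp_le order_trans)
  qed
  obtain B where B: "\<And>t. \<bar>g t\<bar> \<le> B" using g(1) by (auto simp: bounded_iff)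
  define M where "M = \<bar>a\<bar> + B"
  have M: "M \<ge> 0" using B[of 0] by (simp add: M_def)
  have fM: "\<bar>f t\<bar> \<le> M * exp t" for t
    unfolding f abs_mult M_def using B[of t] by (auto intro!: mult_right_mono)
  obtain K where K: "K \<ge> 0" and harn:
    "\<And>u b x y. b \<ge> 0 \<Longrightarrow> x \<in> V \<Longrightarrow> (\<And>z. z \<in> V \<Longrightarrow> u z \<le> u x) \<Longrightarrow>
       (\<And>z. z \<in> V \<Longrightarrow> u x - K * b \<le> u z \<Longrightarrow> - lap u z \<le> b) \<Longrightarrow> y \<in> V \<Longrightarrow> u x - K * b \<le> u y"
    by (rule harnack) blast
  \<comment> \<open>The Harnack-type estimate for \<open>- u n\<close>, whose maximum is at
    \<open>q n\<close>.\<close>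
  have osc: "u n y \<le> m n + K * b"
    if b: "b \<ge> 0" and y: "y \<in> V"
      and L: "\<And>z. z \<in> V \<Longrightarrow> u n z \<le> m n + K * b \<Longrightarrow> lap (u n) z \<le> b" for n b y
    using harn[of b "q n" "\<lambda>x. - u n x" y] b y L q[of _ n] qV[of n]
    by (auto simp: lap_uminus m_def)
  have lap_bound: "lap (u n) z \<le> (\<Sum>x\<in>V. \<mu> x * (\<bar>c\<bar> + \<bar>h x\<bar> * M * exp s))"
    if z: "z \<in> V" and s: "u n z \<le> s" for n z s
  proof -
    have "lap (u n) z = \<mu> z * (c - h z * f (u n z))"
      using sol[of n] z unfolding solution_def by (auto simp: algebra_simps)
    also have "\<dots> \<le> \<mu> z * (\<bar>c\<bar> + \<bar>h z\<bar> * M * exp s)"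
    proof -
      have "\<bar>f (u n z)\<bar> \<le> M * exp s"
        using fM[of "u n z"] mult_left_mono[OF _ M, of "exp (u n z)" "exp s"] s by simp
      then have "\<bar>h z * f (u n z)\<bar> \<le> \<bar>h z\<bar> * (M * exp s)"
        unfolding abs_mult by (intro mult_left_mono) auto
      then have "c - h z * f (u n z) \<le> \<bar>c\<bar> + \<bar>h z\<bar> * M * exp s"
        by (simp add: mult.assoc)
      then show ?thesis using \<mu>[OF z] by simp
    qed
    also have "\<dots> \<le> (\<Sum>x\<in>V. \<mu> x * (\<bar>c\<bar> + \<bar>h x\<bar> * M * exp s))"
      using z finite_V M \<mu> by (intro member_le_sum) (auto simp: less_imp_le)
    finally show ?thesis .
  qed
  define b where "b = (\<Sum>x\<in>V. \<mu> x * (\<bar>c\<bar> + \<bar>h x\<bar> * M * exp 0))"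
  have b: "b \<ge> 0" unfolding b_def using M \<mu> by (intro sum_nonneg) (auto simp: less_imp_le)
  \<comment> \<open>For such \<open>n\<close> all values up to \<open>m n + K * b\<close> are
    nonpositive, so \<open>lap_bound\<close> with \<open>s = 0\<close> yields exactly the constant
    \<open>b\<close> where the estimate asks for it.\<close>
  have "\<forall>\<^sub>F n in sequentially. m n \<le> - K * b"
    using m_lim unfolding filterlim_at_bot by blast
  then have ev: "\<forall>\<^sub>F n in sequentially. \<forall>x\<in>V. u n x \<le> m n + K * b"
  proof eventually_elim
    case (elim n)
    show ?case
      using elim b by (intro ballI osc) (auto intro: lap_bound[where s = 0, folded b_def])
  qed
  have mb_lim: "filterlim (\<lambda>n. m n + K * b) at_bot sequentially"
    by (rule filterlim_compose[OF _ m_lim]) real_asymp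
  have u_lim: "filterlim (\<lambda>n. u n x) at_bot sequentially" if "x \<in> V" for x
    by (rule filterlim_at_bot_mono[OF mb_lim]) (use ev that in \<open>auto elim: eventually_mono\<close>)
  have gu_lim: "(\<lambda>n. g (u n x)) \<longlonglongrightarrow> 0" if "x \<in> V" for x
    using g(2) u_lim[OF that] by (rule filterlim_compose)
  have eu_lim: "(\<lambda>n. exp (u n x)) \<longlonglongrightarrow> 0" if "x \<in> V" for x
    using exp_at_bot u_lim[OF that] by (rule filterlim_compose)
  have "(\<lambda>n. \<Sum>x\<in>V. \<mu> x * h x * f (u n x)) \<longlonglongrightarrow> (\<Sum>x\<in>V. \<mu> x * h x * ((a + 0) * 0))"
    unfolding f by (intro tendsto_intros gu_lim eu_lim)
  then have "c * (\<Sum>x\<in>V. \<mu> x) = 0"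
    unfolding solution_integral[OF sol] by (simp add: LIMSEQ_const_iff)
  moreover have "(\<Sum>x\<in>V. \<mu> x) > 0"
    using finite_V V_nonempty \<mu> by (intro sum_pos) auto
  ultimately have c: "c = 0" by simp
  \<comment> \<open>The estimate is applied a second time, now with the cap
    \<open>m n + K * b\<close> in place of 0. Since \<open>c = 0\<close>, these bounds tend to 0,
    and with them the oscillation.\<close>
  define e where "e n = (\<Sum>x\<in>V. \<mu> x * (\<bar>c\<bar> + \<bar>h x\<bar> * M * exp (m n + K * b)))" for n
  have e0: "e n \<ge> 0" for n
    unfolding e_def using M \<mu> by (intro sum_nonneg) (auto simp: less_imp_le)
  have "e \<longlonglongrightarrow> (\<Sum>x\<in>V. \<mu> x * (\<bar>c\<bar> + \<bar>h x\<bar> * M * 0))"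
    unfolding e_def
    by (intro tendsto_intros filterlim_compose[OF exp_at_bot mb_lim])
  then have "(\<lambda>n. K * e n) \<longlonglongrightarrow> K * 0"
    using c by (intro tendsto_intros) simp
  then have e_lim: "(\<lambda>n. K * e n) \<longlonglongrightarrow> 0" by simp
  have ev2: "\<forall>\<^sub>F n in sequentially. \<forall>x\<in>V. u n x - m n \<le> K * e n"
    using ev
  proof eventually_elim
    case (elim n)
    have "u n x \<le> m n + K * e n" if "x \<in> V" for x
      using e0 that lap_bound[of _ n "m n + K * b", folded e_def] elim
      by (intro osc) auto
    then show ?case by (auto simp: algebra_simps)
  qed
  have d_lim: "(\<lambda>n. u n x - m n) \<longlonglongrightarrow> 0" if "x \<in> V" for x
  proof (rule tendsto_sandwich[OF _ _ tendsto_const e_lim])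
    show "\<forall>\<^sub>F n in sequentially. 0 \<le> u n x - m n"
      using q[OF that] by (simp add: m_def)
    show "\<forall>\<^sub>F n in sequentially. u n x - m n \<le> K * e n"
      using ev2 that by (auto elim: eventually_mono)
  qed
  \<comment> \<open>The integrated equation rescaled by \<open>exp (- m n)\<close>, so that the
    exponential factors tend to 1 instead of 0.\<close>
  have "(\<lambda>n. \<Sum>x\<in>V. \<mu> x * h x * ((a + g (u n x)) * exp (u n x - m n)))
      \<longlonglongrightarrow> (\<Sum>x\<in>V. \<mu> x * h x * ((a + 0) * exp 0))"
    by (intro tendsto_intros gu_lim d_lim)
  moreover have "(\<Sum>x\<in>V. \<mu> x * h x * ((a + g (u n x)) * exp (u n x - m n))) = 0" for n
  proof -
    have "(\<Sum>x\<in>V. \<mu> x * h x * ((a + g (u n x)) * exp (u n x - m n)))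
        = (\<Sum>x\<in>V. \<mu> x * h x * f (u n x)) / exp (m n)"
      unfolding f sum_divide_distrib by (simp add: exp_diff)
    then show ?thesis using solution_integral[OF sol[of n]] c by simp
  qed
  ultimately have "(\<Sum>x\<in>V. \<mu> x * h x * a) = 0"
    by (simp add: LIMSEQ_const_iff)
  then show False
    using a c nondeg by (simp add: sum_distrib_right[symmetric])
qed

section \<open>Upper bound\<close>

text \<open>Eventually \<open>a + g t\<close> exceeds \<open>a / 2\<close>, and a positive multiple
  of the exponential outgrows any affine function.\<close>

lemma eventually_exp_dominates:
  fixes p q r a :: real
  assumes "p > 0" "a > 0" "(g \<longlongrightarrow> 0) at_top"
  shows "\<forall>\<^sub>F t in at_top. q * t + r < p * ((a + g t) * exp t)"
proof -
  have "\<forall>\<^sub>F t in at_top. g t > - a / 2"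
    using assms by (intro order_tendstoD) auto
  moreover have "\<forall>\<^sub>F t in at_top. q * t + r < p * (a / 2 * exp t)"
    using assms by real_asymp
  ultimately show ?thesis
  proof eventually_elim
    case (elim t)
    have "p * (a / 2 * exp t) \<le> p * ((a + g t) * exp t)"
      using elim assms by (intro mult_left_mono mult_right_mono) auto
    with elim show ?case by simp
  qed
qed

text \<open>Where \<open>h > 0\<close>, a large value of \<open>u\<close> needs a very negative neighbour, which the lower bound
  excludes. Hence \<open>h \<le> 0\<close> near a large maximum, so the maximum propagates to all of \<open>V\<close>.\<close>
lemma solution_upper_bound:
  assumes \<mu>: "\<And>x. x \<in> V \<Longrightarrow> \<mu> x > 0"
    and a: "a > 0"
    and f: "\<And>t. f t = (a + g t) * exp t"
    and f_nonneg: "\<And>t. f t \<ge> 0"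
    and g: "(g \<longlongrightarrow> 0) at_top"
    and h: "\<exists>x\<in>V. h x \<noteq> 0"
    and lower: "\<And>u x. solution \<mu> h f c u \<Longrightarrow> x \<in> V \<Longrightarrow> - N \<le> u x"
  obtains T where "\<And>u x. solution \<mu> h f c u \<Longrightarrow> x \<in> V \<Longrightarrow> u x \<le> T"
proof -
  obtain K where K: "K \<ge> 0" and harn:
    "\<And>u b x y. b \<ge> 0 \<Longrightarrow> x \<in> V \<Longrightarrow> (\<And>z. z \<in> V \<Longrightarrow> u z \<le> u x) \<Longrightarrow>
       (\<And>z. z \<in> V \<Longrightarrow> u x - K * b \<le> u z \<Longrightarrow> - lap u z \<le> b) \<Longrightarrow> y \<in> V \<Longrightarrow> u x - K * b \<le> u y"
    by (rule harnack) blast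
  define b where "b = (\<Sum>x\<in>V. \<mu> x * \<bar>c\<bar>)"
  have b: "b \<ge> 0" unfolding b_def using \<mu> by (intro sum_nonneg) (auto simp: less_imp_le)
  \<comment> \<open>The affine side is \<open>deg x * (t + N)\<close>, the largest
    \<open>- lap u x\<close> possible when \<open>u x = t\<close> and all neighbours are at least
    \<open>- N\<close>, plus the contribution of \<open>c\<close>.\<close>
  have ev_pos: "\<forall>\<^sub>F t in at_top. \<forall>x\<in>{x\<in>V. h x > 0}.
      deg x * t + (deg x * N + \<mu> x * c) < \<mu> x * h x * ((a + g t) * exp t)"
    using finite_V \<mu> a g
    by (intro eventually_ball_finite ballI eventually_exp_dominates) auto
  \<comment> \<open>Here \<open>deg x * (K * b)\<close> is the largest \<open>lap u x\<close>
    possible when no neighbour exceeds \<open>u x\<close> by more than \<open>K * b\<close>.\<close>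
  have ev_neg: "\<forall>\<^sub>F t in at_top. \<forall>x\<in>{x\<in>V. h x < 0}.
      0 * t + (deg x * (K * b) - \<mu> x * c) < - (\<mu> x * h x) * ((a + g t) * exp t)"
    using finite_V \<mu> a g
    by (intro eventually_ball_finite ballI eventually_exp_dominates) (auto simp: mult_pos_neg)
  obtain T where T: "\<And>t x. t \<ge> T \<Longrightarrow> x \<in> V \<Longrightarrow> h x > 0 \<Longrightarrow>
      deg x * t + (deg x * N + \<mu> x * c) < \<mu> x * h x * f t"
    "\<And>t x. t \<ge> T \<Longrightarrow> x \<in> V \<Longrightarrow> h x < 0 \<Longrightarrow> deg x * (K * b) - \<mu> x * c < - (\<mu> x * h x) * f t"
    using eventually_conj[OF ev_pos ev_neg] unfolding eventually_at_top_linorder f by auto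
  have "u y \<le> T + K * b" if sol: "solution \<mu> h f c u" and y: "y \<in> V" for u y
  proof -
    obtain x where x: "x \<in> V" and max: "\<And>z. z \<in> V \<Longrightarrow> u z \<le> u x"
      using finite_V V_nonempty
      by (metis ex_is_arg_min_if_finite[of V "\<lambda>z. - u z"] is_arg_min_linorder neg_le_iff_le)
    have L: "- lap u z = \<mu> z * h z * f (u z) - \<mu> z * c" if "z \<in> V" for z
      using sol that by (simp add: solution_def algebra_simps)
    have h_le: "h z \<le> 0" if z: "z \<in> V" and uz: "T \<le> u z" for z
    proof (rule ccontr)
      assume "\<not> h z \<le> 0"
      then have "deg z * u z + deg z * N < - lap u z"
        using T(1)[OF uz z] L[OF z] by simp
      also have "\<dots> = lap (\<lambda>x. - u x) z" by (simp add: lap_uminus)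
      also have "\<dots> \<le> deg z * (u z + N)"
        using lower[OF sol] E_subset by (intro lap_le) force
      finally show False by (simp add: algebra_simps)
    qed
    have "u x \<le> T + K * b"
    proof (rule ccontr)
      assume *: "\<not> u x \<le> T + K * b"
      \<comment> \<open>The margin \<open>K * b\<close> above \<open>T\<close> keeps the whole zone
        examined by the estimate above \<open>T\<close>. There \<open>h\<close> is nonpositive and
        \<open>f\<close> nonnegative, so only \<open>c\<close> can make \<open>- lap u\<close>
        positive.\<close>
      have low: "u x - K * b \<le> u z" if z: "z \<in> V" for z
      proof (rule harn[where u = u and b = b and x = x])
        fix v assume v: "v \<in> V" "u x - K * b \<le> u v"
        have "\<mu> v * h v * f (u v) \<le> 0"
          using h_le[of v] v * \<mu>[of v] f_nonneg[of "u v"]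
          by (simp add: mult_nonneg_nonpos mult_nonpos_nonneg)
        then have "- lap u v \<le> \<mu> v * \<bar>c\<bar>"
          using L[OF v(1)] \<mu>[OF v(1)]
            mult_left_mono[OF abs_ge_minus_self[of c], of "\<mu> v"] by simp
        also have "\<dots> \<le> b"
          unfolding b_def using v finite_V \<mu> by (intro member_le_sum) (auto simp: less_imp_le)
        finally show "- lap u v \<le> b" .
      qed (use b x max z in auto)
      obtain z where z: "z \<in> V" "h z \<noteq> 0" using h by blast
      have uz: "T \<le> u z" using low[OF z(1)] * by simp
      then have "h z < 0" using h_le[OF z(1)] z(2) by simp
      then have "deg z * (K * b) < lap u z"
        using T(2)[OF uz z(1)] L[OF z(1)] by simp
      also have "lap u z \<le> deg z * (K * b)"
      proof (rule lap_le)
        fix v assume "(z, v) \<in> E"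
        then have "u v \<le> u x" using max E_subset by auto
        then show "u v - u z \<le> K * b" using low[OF z(1)] by simp
      qed
      finally show False by simp
    qed
    then show ?thesis using max[OF y] by simp
  qed
  then show thesis by (rule that)
qed

end

section \<open>Combination of the two bounds\<close>

theorem theorem3:
  fixes G :: "'a pair_pre_digraph"
    and \<mu> :: "'a \<Rightarrow> real"
    and w :: "'a \<Rightarrow> 'a \<Rightarrow> real"
    and f g :: "real \<Rightarrow> real"
    and h :: "'a \<Rightarrow> real"
    and a c :: real
  assumes "pair_graph G"
    and "Digraph_Component.connected (with_proj G)"
    and "\<And>x. x \<in> pverts G \<Longrightarrow> \<mu> x > 0"
    and "\<And>x y. (x, y) \<in> parcs G \<Longrightarrow> w x y > 0"
    and "\<And>x y. (x, y) \<in> parcs G \<Longrightarrow> w x y = w y x"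
    and "a > 0"
    and "\<And>t. f t = a * exp t + g t * exp t"
    and "\<And>t. f t > 0"
    and "bounded (range g)"
    and "(g \<longlongrightarrow> 0) at_top"
    and "(g \<longlongrightarrow> 0) at_bot"
    and "c > 0 \<Longrightarrow> \<exists>x0\<in>pverts G. h x0 > 0"
    and "c = 0 \<Longrightarrow> changes_sign G h \<and> graph_integral G \<mu> h < 0"
    and "c < 0 \<Longrightarrow> \<exists>x0\<in>pverts G. h x0 < 0"
  shows "\<exists>C. \<forall>u :: 'a \<Rightarrow> real.
    (\<forall>x\<in>pverts G. - graph_laplacian G \<mu> w u x = h x * f (u x) - c) \<longrightarrow>
    (MAX x\<in>pverts G. \<bar>u x\<bar>) \<le> C"
proof -
  interpret G: pair_graph G by fact
  \<comment> \<open>Since every arc has its reverse, connectedness of the underlying undirected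
    graph yields directed paths between all vertices.\<close>
  have sc: "strongly_connected (with_proj G)"
    by (rule G.symmetric_connected_imp_strongly_connected[OF G.sym_arcs assms(2)])
  interpret weighted_graph "pverts G" "parcs G" w
  proof
    show "sym (parcs G)" by (auto intro!: symI G.arcs_symmetric)
    show "parcs G \<subseteq> pverts G \<times> pverts G" by (auto dest: G.in_arcsD1 G.in_arcsD2)
    show "(x, y) \<in> (parcs G)\<^sup>*" if "x \<in> pverts G" "y \<in> pverts G" for x y
      using sc that reachable_rtranclI[of "with_proj G" x y]
      by (auto simp: strongly_connected_def)
    show "w x y = w y x" if "(x, y) \<in> parcs G" for x y
      using that by (rule assms(5))
  qed (use sc assms(4) in \<open>auto simp: strongly_connected_def\<close>)
  have f: "f t = (a + g t) * exp t" for t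
    by (simp add: assms(7) algebra_simps)
  have sol: "solution \<mu> h f c u"
    if "\<forall>x\<in>pverts G. - graph_laplacian G \<mu> w u x = h x * f (u x) - c" for u
    unfolding solution_def
  proof
    fix x assume x: "x \<in> pverts G"
    have "graph_laplacian G \<mu> w u x = lap u x / \<mu> x"
      by (simp add: graph_laplacian_def lap_def)
    then show "- lap u x = \<mu> x * (h x * f (u x) - c)"
      using that x assms(3)[OF x] by (force simp: field_simps)
  qed
  have nondeg: "c \<noteq> 0 \<or> (\<Sum>x\<in>pverts G. \<mu> x * h x) \<noteq> 0"
    using assms(13) by (auto simp: graph_integral_def)
  have "a \<noteq> 0" using assms(6) by simp
  obtain N where N: "\<And>u x. solution \<mu> h f c u \<Longrightarrow> x \<in> pverts G \<Longrightarrow> - N \<le> u x"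
    by (rule solution_lower_bound[OF assms(3) \<open>a \<noteq> 0\<close> f assms(9,11) nondeg]) blast+
  have h: "\<exists>x\<in>pverts G. h x \<noteq> 0"
    using assms(12-14) unfolding changes_sign_def by (cases c "0::real" rule: linorder_cases) force+
  obtain T where T: "\<And>u x. solution \<mu> h f c u \<Longrightarrow> x \<in> pverts G \<Longrightarrow> u x \<le> T"
    by (rule solution_upper_bound[where N = N, OF assms(3,6) f less_imp_le[OF assms(8)] assms(10) h])
      (use N in blast)+
  show ?thesis
  proof (intro exI allI impI)
    fix u assume "\<forall>x\<in>pverts G. - graph_laplacian G \<mu> w u x = h x * f (u x) - c"
    then have u: "solution \<mu> h f c u" by (rule sol)
    have "\<bar>u x\<bar> \<le> max N T" if "x \<in> pverts G" for x
      using N[OF u that] T[OF u that] by auto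
    then show "(MAX x\<in>pverts G. \<bar>u x\<bar>) \<le> max N T"
      using finite_V V_nonempty by (intro Max.boundedI) auto
  qed
qed

end
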